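(* Let $\gamma\in\mathbb{R}$, $K>0$, and consider the stochastic dynamic on $\{+1,-1\}^{\mathbb{Z}}$ $$\phi(x,t+1)=\mathrm{sgn}\{K_{\lambda(t)}(\phi(x-1,t)+\phi(x+1,t))+(1-\gamma)\phi(x,t)+\xi(x,t)\},\qquad x\in\mathbb{Z},\ t=0,1,2,\dots,$$ with initial distribution $\phi(\cdot,0)\sim\mathbb{P}_0$, where $\mathbb{P}_0$ is the infinite-volume Gibbs measure of the zero-field nearest-neighbour Ising model on $\mathbb{Z}$ with coupling $K$, and with $K_{\lambda(t)}\to K^*=0$ as $\lambda(t)\to\infty$. Let $f,g:\{+1,-1\}\to\mathbb{R}$ and let $x_1\ne x_2$ be sites in $\mathbb{Z}$. Taking the factor $Z(\lambda(t))=1$ in the observable renormalization group equation $\mathcal{S}^{fg}_{\lambda(t)}(x_1,x_2)-Z^{-1}(\lambda(t))\mathcal{S}^{fg}(\lambda(t)x_1,\lambda(t)x_2)=\mathcal{O}_{\lambda(t)}(x_1,x_2)$, one has $$\mathcal{S}^{fg}_{\lambda(t)}(x_1,x_2)-\mathcal{S}^{fg}(\lambda(t)x_1,\lambda(t)x_2)\to0$$ as $t\to\infty$ and $\lambda(t)\to\infty$.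
   Context: The $\{\xi(x,t)\}_{x\in\mathbb{Z},t\ge0}$ are independent standard Gaussian random variables, independent of $\phi(\cdot,0)$. $\lambda(t)>0$ is a deterministic scaling factor such that $\lambda(t)x_1,\lambda(t)x_2\in\mathbb{Z}$, and $K_{\lambda(t)}$ is a deterministic real coupling parameter depending on $t$ through $\lambda(t)$. $\mathbb{P}_0$ satisfies the DLR equations: for every finite $\Lambda\subset\mathbb{Z}$, $\mathbb{P}_0(\phi(x,0)=\sigma_x,x\in\Lambda\mid\phi(y,0)=\sigma_y,y\in\Lambda^c)=Z_{\partial_\Lambda}^{-1}\exp\{K\sum\sigma_x\sigma_y\}$, the sum being over nearest-neighbour pairs $\{x,y\}$ with at least one element in $\Lambda$, and $Z_{\partial_\Lambda}$ the normalizing constant. Observables: $\mathcal{S}^{fg}_{\lambda(t)}(x_1,x_2)=\mathbb{E}[F\log F]-\mathbb{E}[F]\log\mathbb{E}[F]$ with $F=f^2(\phi(x_1,t+1))g^2(\phi(x_2,t+1))$ and $\mathbb{E}$ the expectation for the dynamic. For sites $y_1,y_2\in\mathbb{Z}$, $\mathcal{S}^{fg}(y_1,y_2)=\mathbb{E}_{\mathbb{P}_0}[G\log G]-\mathbb{E}_{\mathbb{P}_0}[G]\log\mathbb{E}_{\mathbb{P}_0}[G]$ with $G=f^2(\phi(y_1,0))g^2(\phi(y_2,0))$. Convention $0\log0=0$. *)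

theory Defs
  imports "HOL-Probability.Probability"
begin

definition spin_space :: "(int \<Rightarrow> real) measure" where
  "spin_space = (\<Pi>\<^sub>M x\<in>UNIV. count_space {-1, 1})"

text \<open>Events that depend only on the spins outside \<open>\<Lambda>\<close>.\<close>

definition outside_algebra :: "int set \<Rightarrow> (int \<Rightarrow> real) measure" where
  "outside_algebra \<Lambda> =
     vimage_algebra (space spin_space) (\<lambda>\<eta>. restrict \<eta> (- \<Lambda>)) (\<Pi>\<^sub>M x\<in>- \<Lambda>. count_space {-1, 1})"

definition nn_pairs :: "int set \<Rightarrow> int set set" where
  "nn_pairs \<Lambda> = {{x, y} | x y. \<bar>x - y\<bar> = 1 \<and> {x, y} \<inter> \<Lambda> \<noteq> {}}"

text \<open>Boltzmann weight of the configuration that is \<open>\<sigma>\<close> on \<open>\<Lambda>\<close> and equals the boundary condition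
  \<open>\<eta>\<close> off \<open>\<Lambda>\<close>; the product over the two-element set \<open>e = {x, y}\<close> is \<open>\<sigma>\<^sub>x\<sigma>\<^sub>y\<close>.\<close>

definition boltzmann_weight :: "real \<Rightarrow> int set \<Rightarrow> (int \<Rightarrow> real) \<Rightarrow> (int \<Rightarrow> real) \<Rightarrow> real" where
  "boltzmann_weight K \<Lambda> \<eta> \<sigma> = exp (K * (\<Sum>e\<in>nn_pairs \<Lambda>. \<Prod>x\<in>e. override_on \<eta> \<sigma> \<Lambda> x))"

definition partition_fun :: "real \<Rightarrow> int set \<Rightarrow> (int \<Rightarrow> real) \<Rightarrow> real" where
  "partition_fun K \<Lambda> \<eta> = (\<Sum>\<sigma>\<in>\<Lambda> \<rightarrow>\<^sub>E {-1, 1}. boltzmann_weight K \<Lambda> \<eta> \<sigma>)"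

text \<open>The DLR equations: the left-hand side below is a version of the conditional probability of
  \<open>{\<phi>(x) = \<sigma>\<^sub>x, x \<in> \<Lambda>}\<close> given the spins off \<open>\<Lambda>\<close>, evaluated at the configuration \<open>\<eta>\<close>.\<close>

definition ising_gibbs_measure :: "real \<Rightarrow> (int \<Rightarrow> real) measure \<Rightarrow> bool" where
  "ising_gibbs_measure K P \<longleftrightarrow>
     prob_space P \<and> sets P = sets spin_space \<and>
     (\<forall>\<Lambda> \<sigma>. finite \<Lambda> \<longrightarrow> \<sigma> \<in> UNIV \<rightarrow> {-1, 1} \<longrightarrow>
        (AE \<eta> in P. real_cond_exp P (outside_algebra \<Lambda>) (indicator {\<phi> \<in> space P. \<forall>x\<in>\<Lambda>. \<phi> x = \<sigma> x}) \<eta>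
                    = boltzmann_weight K \<Lambda> \<eta> \<sigma> / partition_fun K \<Lambda> \<eta>))"

text \<open>Since \<open>ln 0 = 0\<close> (and \<open>0 * a = 0\<close>) in HOL, the convention \<open>0 log 0 = 0\<close> is built in.\<close>

definition entropy_functional :: "'w measure \<Rightarrow> ('w \<Rightarrow> real) \<Rightarrow> real" where
  "entropy_functional M F =
     (\<integral>\<omega>. F \<omega> * ln (F \<omega>) \<partial>M) - (\<integral>\<omega>. F \<omega> \<partial>M) * ln (\<integral>\<omega>. F \<omega> \<partial>M)"

definition dyn_entropy ::
  "'w measure \<Rightarrow> (int \<Rightarrow> nat \<Rightarrow> 'w \<Rightarrow> real) \<Rightarrow> (real \<Rightarrow> real) \<Rightarrow> (real \<Rightarrow> real) \<Rightarrow> nat \<Rightarrow> int \<Rightarrow> int \<Rightarrow> real" where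
  "dyn_entropy M \<phi> f g t x1 x2 =
     entropy_functional M (\<lambda>\<omega>. (f (\<phi> x1 (t + 1) \<omega>))\<^sup>2 * (g (\<phi> x2 (t + 1) \<omega>))\<^sup>2)"

definition gibbs_entropy ::
  "(int \<Rightarrow> real) measure \<Rightarrow> (real \<Rightarrow> real) \<Rightarrow> (real \<Rightarrow> real) \<Rightarrow> int \<Rightarrow> int \<Rightarrow> real" where
  "gibbs_entropy P f g y1 y2 = entropy_functional P (\<lambda>\<eta>. (f (\<eta> y1))\<^sup>2 * (g (\<eta> y2))\<^sup>2)"

text \<open>The process \<open>\<phi>\<close> on the probability space \<open>M\<close>, driven by the noise \<open>\<xi>\<close>, with coupling
  \<open>\<kappa> t\<close> at time \<open>t\<close> and initial law \<open>P0\<close>. Spins are \<open>\<plusminus>1\<close> everywhere; the update is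
  imposed almost surely because \<open>sgn 0 = 0\<close>, but the argument of \<open>sgn\<close> has a Gaussian
  component independent of the rest and hence vanishes with probability zero. The library's
  \<open>indep_var\<close> needs both variables to have the same range type, so independence of the noise
  and the initial configuration is stated for the generated \<open>\<sigma>\<close>-algebras.\<close>

definition ising_dynamic ::
  "'w measure \<Rightarrow> (int \<Rightarrow> nat \<Rightarrow> 'w \<Rightarrow> real) \<Rightarrow> (int \<Rightarrow> nat \<Rightarrow> 'w \<Rightarrow> real) \<Rightarrow> real \<Rightarrow> (nat \<Rightarrow> real)
     \<Rightarrow> (int \<Rightarrow> real) measure \<Rightarrow> bool" where
  "ising_dynamic M \<phi> \<xi> \<gamma> \<kappa> P0 \<longleftrightarrow>
     prob_space M \<and>
     prob_space.indep_vars M (\<lambda>_. borel) (\<lambda>(x, t). \<xi> x t) UNIV \<and>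
     (\<forall>x t. distributed M lborel (\<xi> x t) std_normal_density) \<and>
     prob_space.indep_set M
       (sets (vimage_algebra (space M) (\<lambda>\<omega> (x, t). \<xi> x t \<omega>) (\<Pi>\<^sub>M _\<in>UNIV. borel)))
       (sets (vimage_algebra (space M) (\<lambda>\<omega> x. \<phi> x 0 \<omega>) spin_space)) \<and>
     (\<forall>x t. \<phi> x t \<in> measurable M (count_space {-1, 1})) \<and>
     distr M spin_space (\<lambda>\<omega> x. \<phi> x 0 \<omega>) = P0 \<and>
     (\<forall>x t. AE \<omega> in M. \<phi> x (t + 1) \<omega> =
        sgn (\<kappa> t * (\<phi> (x - 1) t \<omega> + \<phi> (x + 1) t \<omega>) + (1 - \<gamma>) * \<phi> x t \<omega> + \<xi> x t \<omega>))"

end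

theory Submission
  imports Defs
begin

text \<open>
  The entropy of a function of two spins depends continuously on the two means and the
  correlation of the spins, so it suffices that these tend to \<open>0\<close> on both sides; both entropies
  then tend to the value for two independent fair spins.

  For the Gibbs measure, the DLR equation at a single site \<open>y\<close> says that, with
  \<open>\<theta> = tanh (2 K)\<close>, integrating \<open>\<sigma>\<^sub>y\<close> against a function of the other spins gives the same as
  integrating \<open>\<theta> (\<sigma>\<^bsub>y - 1\<^esub> + \<sigma>\<^bsub>y + 1\<^esub>) / 2\<close>. Iterating this \<open>n\<close> times bounds the mean by
  \<open>\<theta>\<^sup>n\<close> for every \<open>n\<close>, and the correlation at distance \<open>n\<close> by \<open>\<theta>\<^sup>n\<close>.

  For the dynamic, dropping the coupling term changes a spin with probability \<open>O(\<kappa>\<^sub>t)\<close>, as the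
  Gaussian noise must then fall into an interval of that length. Without coupling, one
  step multiplies the mean by \<open>c = E sgn (1 - \<gamma> + \<xi>)\<close> and the correlation by \<open>c\<^sup>2\<close>, where
  \<open>\<bar>c\<bar> < 1\<close>. Hence both tend to \<open>0\<close>, whatever the initial law.
\<close>

section \<open>Entropy of a pair of spins\<close>

text \<open>The expectation of \<open>h\<close> at two independent fair spins. Both entropies will
  be shown to converge to the value computed with it.\<close>

definition uniform_mean :: "(real \<Rightarrow> real \<Rightarrow> real) \<Rightarrow> real" where
  "uniform_mean h = (h 1 1 + h 1 (-1) + h (-1) 1 + h (-1) (-1)) / 4"

lemma spin_borel_measurable:
  "A \<in> measurable M (count_space {-1, 1}) \<Longrightarrow> A \<in> borel_measurable M"
  for A :: "'w \<Rightarrow> real"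
  by (rule measurable_compose[where f=A and g="\<lambda>x. x"]) auto

lemma spin_cases:
  fixes A :: "'w \<Rightarrow> real"
  assumes "A \<in> measurable M (count_space {-1, 1})" "\<omega> \<in> space M"
  shows "A \<omega> = -1 \<or> A \<omega> = 1"
  using measurable_space[OF assms] by auto

text \<open>A function on four points is a linear combination of 1, the two spins and their product,
  so only the two means and the correlation enter. Each bracket divided by 4 is the joint
  probability of the corresponding pair of values.\<close>

lemma (in prob_space) expectation_spin_pair:
  fixes h :: "real \<Rightarrow> real \<Rightarrow> real"
  assumes A: "A \<in> measurable M (count_space {-1, 1})"
    and B: "B \<in> measurable M (count_space {-1, 1})"
  defines "a \<equiv> expectation A" and "b \<equiv> expectation B" and "c \<equiv> expectation (\<lambda>\<omega>. A \<omega> * B \<omega>)"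
  shows "expectation (\<lambda>\<omega>. h (A \<omega>) (B \<omega>)) =
    (h 1 1 * (1 + a + b + c) + h 1 (-1) * (1 + a - b - c)
      + h (-1) 1 * (1 - a + b - c) + h (-1) (-1) * (1 - a - b + c)) / 4"
proof -
  \<comment> \<open>Fourier coefficients of \<open>h\<close> with respect to 1, \<open>A\<close>,
    \<open>B\<close> and \<open>A * B\<close>.\<close>
  define k0 where "k0 = (h 1 1 + h 1 (-1) + h (-1) 1 + h (-1) (-1)) / 4"
  define ka where "ka = (h 1 1 + h 1 (-1) - h (-1) 1 - h (-1) (-1)) / 4"
  define kb where "kb = (h 1 1 - h 1 (-1) + h (-1) 1 - h (-1) (-1)) / 4"
  define kc where "kc = (h 1 1 - h 1 (-1) - h (-1) 1 + h (-1) (-1)) / 4"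
  note [measurable] = spin_borel_measurable[OF A] spin_borel_measurable[OF B]
  have bd: "\<bar>A \<omega>\<bar> \<le> 1" "\<bar>B \<omega>\<bar> \<le> 1" "\<bar>A \<omega> * B \<omega>\<bar> \<le> 1" if "\<omega> \<in> space M" for \<omega>
    using spin_cases[OF A that] spin_cases[OF B that] by auto
  have int: "integrable M A" "integrable M B" "integrable M (\<lambda>\<omega>. A \<omega> * B \<omega>)"
    by (rule integrable_const_bound[where B=1], auto intro!: AE_I2 bd)+
  have "expectation (\<lambda>\<omega>. h (A \<omega>) (B \<omega>)) =
      expectation (\<lambda>\<omega>. k0 + ka * A \<omega> + kb * B \<omega> + kc * (A \<omega> * B \<omega>))"
  proof (rule Bochner_Integration.integral_cong[OF refl])
    fix \<omega> assume w: "\<omega> \<in> space M"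
    show "h (A \<omega>) (B \<omega>) = k0 + ka * A \<omega> + kb * B \<omega> + kc * (A \<omega> * B \<omega>)"
      using spin_cases[OF A w] spin_cases[OF B w]
      by (auto simp: k0_def ka_def kb_def kc_def field_simps)
  qed
  also have "\<dots> = k0 + ka * a + kb * b + kc * c"
    using int by (simp add: prob_space a_def b_def c_def)
  finally show ?thesis
    by (simp add: k0_def ka_def kb_def kc_def field_simps)
qed

lemma (in prob_space) expectation_spin_pair_limit:
  fixes h :: "real \<Rightarrow> real \<Rightarrow> real"
  assumes A: "\<And>n. A n \<in> measurable M (count_space {-1, 1})"
    and B: "\<And>n. B n \<in> measurable M (count_space {-1, 1})"
    and a: "(\<lambda>n. expectation (A n)) \<longlonglongrightarrow> 0"
    and b: "(\<lambda>n. expectation (B n)) \<longlonglongrightarrow> 0"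
    and c: "(\<lambda>n. expectation (\<lambda>\<omega>. A n \<omega> * B n \<omega>)) \<longlonglongrightarrow> 0"
  shows "(\<lambda>n. expectation (\<lambda>\<omega>. h (A n \<omega>) (B n \<omega>))) \<longlonglongrightarrow> uniform_mean h"
proof -
  have "(\<lambda>n. expectation (\<lambda>\<omega>. h (A n \<omega>) (B n \<omega>))) \<longlonglongrightarrow>
      (h 1 1 * (1 + 0 + 0 + 0) + h 1 (-1) * (1 + 0 - 0 - 0)
        + h (-1) 1 * (1 - 0 + 0 - 0) + h (-1) (-1) * (1 - 0 - 0 + 0)) / 4"
    unfolding expectation_spin_pair[OF A B, where h=h]
    by (intro tendsto_add tendsto_diff tendsto_mult tendsto_divide tendsto_const a b c) simp
  then show ?thesis by (simp add: uniform_mean_def)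
qed

text \<open>The integrand \<open>h * ln h\<close> is itself a function of the two spins, so its
  limit is another instance of the previous lemma; only the outer logarithm calls for a continuity
  argument.\<close>

lemma (in prob_space) entropy_spin_pair_limit:
  fixes h :: "real \<Rightarrow> real \<Rightarrow> real"
  assumes A: "\<And>n. A n \<in> measurable M (count_space {-1, 1})"
    and B: "\<And>n. B n \<in> measurable M (count_space {-1, 1})"
    and a: "(\<lambda>n. expectation (A n)) \<longlonglongrightarrow> 0"
    and b: "(\<lambda>n. expectation (B n)) \<longlonglongrightarrow> 0"
    and c: "(\<lambda>n. expectation (\<lambda>\<omega>. A n \<omega> * B n \<omega>)) \<longlonglongrightarrow> 0"
    and nonneg: "\<And>r s. 0 \<le> h r s"
  shows "(\<lambda>n. entropy_functional M (\<lambda>\<omega>. h (A n \<omega>) (B n \<omega>)))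
    \<longlonglongrightarrow> uniform_mean (\<lambda>r s. h r s * ln (h r s)) - uniform_mean h * ln (uniform_mean h)"
proof -
  note lim = expectation_spin_pair_limit[OF A B a b c]
  have "(\<lambda>n. expectation (\<lambda>\<omega>. h (A n \<omega>) (B n \<omega>)) * ln (expectation (\<lambda>\<omega>. h (A n \<omega>) (B n \<omega>))))
      \<longlonglongrightarrow> uniform_mean h * ln (uniform_mean h)"
  \<comment> \<open>\<open>ln\<close> is discontinuous at 0. If the limit is 0, nonnegativity makes
    \<open>h\<close> vanish at all four spin pairs, and the sequence is constantly 0; otherwise
    \<open>ln\<close> is continuous at the limit.\<close>
  proof (cases "uniform_mean h = 0")
    case True
    then have "h 1 1 = 0" "h 1 (-1) = 0" "h (-1) 1 = 0" "h (-1) (-1) = 0"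
      using nonneg[of 1 1] nonneg[of 1 "-1"] nonneg[of "-1" 1] nonneg[of "-1" "-1"]
      by (auto simp: uniform_mean_def)
    then have "expectation (\<lambda>\<omega>. h (A n \<omega>) (B n \<omega>)) = 0" for n
      unfolding expectation_spin_pair[OF A B, where h=h] by simp
    then show ?thesis using True by simp
  next
    case False
    show ?thesis by (rule tendsto_mult[OF lim[of h] tendsto_ln[OF lim[of h] False]])
  qed
  then show ?thesis
    unfolding entropy_functional_def by (rule tendsto_diff[OF lim[of "\<lambda>r s. h r s * ln (h r s)"]])
qed

section \<open>Gaussian noise\<close>

text \<open>With \<Phi> the standard normal distribution function this is 2 \<Phi>(a) - 1. At
  \<open>a = 1 - \<gamma>\<close> it is the factor by which one uncoupled step multiplies the mean
  of a spin.\<close>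

definition gaussian_sgn_mean :: "real \<Rightarrow> real" where
  "gaussian_sgn_mean a = (\<integral>x. std_normal_density x * sgn (a + x) \<partial>lborel)"

lemma integrable_normal_density_sgn: "integrable lborel (\<lambda>x. std_normal_density x * sgn (a + x))"
  by (rule Bochner_Integration.integrable_bound[OF integrable_normal_density[of 1 0]])
     (auto simp: abs_mult sgn_if)

text \<open>Substitute -x for x: the density is even and \<open>sgn\<close> is odd.\<close>

lemma gaussian_sgn_mean_minus: "gaussian_sgn_mean (- a) = - gaussian_sgn_mean a"
proof -
  have "gaussian_sgn_mean (- a) = (\<integral>x. std_normal_density (- x) * sgn (- a - x) \<partial>lborel)"
    unfolding gaussian_sgn_mean_def by (subst lborel_integral_real_affine[where c="-1" and t=0]) auto
  also have "\<dots> = (\<integral>x. - (std_normal_density x * sgn (a + x)) \<partial>lborel)"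
    by (intro Bochner_Integration.integral_cong) (auto simp: normal_density_def sgn_if)
  finally show ?thesis by (simp add: gaussian_sgn_mean_def)
qed

lemma gaussian_sgn_mean_less_1: "gaussian_sgn_mean a < 1"
proof (rule ccontr)
  assume "\<not> gaussian_sgn_mean a < 1"
  define F where "F = (\<lambda>x. std_normal_density x * (1 - sgn (a + x)))"
  have F: "F = (\<lambda>x. std_normal_density x - std_normal_density x * sgn (a + x))"
    by (simp add: F_def algebra_simps)
  have int: "integrable lborel F"
    unfolding F by (intro Bochner_Integration.integrable_diff integrable_normal_density_sgn) simp
  have nonneg: "AE x in lborel. 0 \<le> F x" by (auto simp: F_def sgn_if)
  have "integral\<^sup>L lborel F = 1 - gaussian_sgn_mean a"
    unfolding F gaussian_sgn_mean_def by (simp add: integrable_normal_density_sgn)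
  then have "integral\<^sup>L lborel F = 0"
    using integral_nonneg_AE[OF nonneg] \<open>\<not> gaussian_sgn_mean a < 1\<close> by simp
  then have "AE x in lborel. F x = 0"
    using integral_nonneg_eq_0_iff_AE[OF int nonneg] by simp
  \<comment> \<open>\<open>F\<close> is positive wherever \<open>a + x \<le> 0\<close>, in
    particular on this interval, whose length 1 gives the contradiction.\<close>
  then have "AE x in lborel. x \<notin> {- a - 1..- a}"
    by eventually_elim (auto simp: F_def sgn_if normal_density_def split: if_splits)
  then have "emeasure lborel {- a - 1..- a} = 0"
    by (subst (asm) AE_iff_measurable[where N="{- a - 1..- a}"]) auto
  then show False by simp
qed

lemma abs_gaussian_sgn_mean_less_1: "\<bar>gaussian_sgn_mean a\<bar> < 1"
  using gaussian_sgn_mean_less_1[of a] gaussian_sgn_mean_less_1[of "- a"]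
  by (simp add: gaussian_sgn_mean_minus abs_if)

lemma std_normal_density_le_1: "std_normal_density x \<le> 1"
proof -
  have "1 \<le> sqrt (2 * pi)" using pi_gt3 by (intro real_le_rsqrt) simp
  then show ?thesis
    by (auto simp: std_normal_density_def divide_le_eq intro: order_trans[of _ 1])
qed

text \<open>The event confines \<open>X\<close> to an interval of length \<open>2 * d\<close>, and
  the density is at most 1.\<close>

lemma (in prob_space) std_normal_small_ball:
  assumes X: "distributed M lborel X std_normal_density" and "0 \<le> d"
  shows "prob {\<omega>\<in>space M. \<bar>b + X \<omega>\<bar> \<le> d} \<le> 2 * d"
proof -
  have "emeasure M {\<omega>\<in>space M. \<bar>b + X \<omega>\<bar> \<le> d} = emeasure M (X -` {- b - d..- b + d} \<inter> space M)"
    by (rule arg_cong[where f="emeasure M"]) auto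
  also have "\<dots> = (\<integral>\<^sup>+x. std_normal_density x * indicator {- b - d..- b + d} x \<partial>lborel)"
    by (subst distributed_emeasure[OF X]) (auto intro!: nn_integral_cong split: split_indicator)
  also have "\<dots> \<le> (\<integral>\<^sup>+x. indicator {- b - d..- b + d} x \<partial>lborel)"
    by (intro nn_integral_mono) (auto split: split_indicator simp: std_normal_density_le_1)
  also have "\<dots> = ennreal (2 * d)" using \<open>0 \<le> d\<close> by simp
  finally show ?thesis using \<open>0 \<le> d\<close> by (simp add: emeasure_eq_measure)
qed

text \<open>Once the errors stay below a small \<open>d\<close>, iterating the inequality leaves a
  geometrically decaying term plus at most \<open>d / (1 - c)\<close>.\<close>

lemma contraction_tendsto_zero:
  fixes m e :: "nat \<Rightarrow> real"
  assumes c: "0 \<le> c" "c < 1" and step: "\<And>n. \<bar>m (Suc n)\<bar> \<le> c * \<bar>m n\<bar> + e n"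
    and e: "e \<longlonglongrightarrow> 0"
  shows "m \<longlonglongrightarrow> 0"
proof (rule LIMSEQ_I)
  fix r :: real assume "0 < r"
  \<comment> \<open>Chosen so that \<open>r / 2\<close> is the fixed point of the map sending u to
    \<open>c * u + d\<close>; the other half of \<open>r\<close> is left for the geometric
    term.\<close>
  define d where "d = r * (1 - c) / 2"
  have "0 < d" using \<open>0 < r\<close> c by (simp add: d_def)
  from LIMSEQ_D[OF e this] obtain N where N: "\<And>n. n \<ge> N \<Longrightarrow> \<bar>e n\<bar> < d" by auto
  have bound: "\<bar>m (N + k)\<bar> \<le> c ^ k * \<bar>m N\<bar> + r / 2" for k
  proof (induction k)
    case 0 show ?case using \<open>0 < r\<close> by simp
  next
    case (Suc k)
    have "\<bar>m (N + Suc k)\<bar> \<le> c * \<bar>m (N + k)\<bar> + e (N + k)" using step[of "N + k"] by simp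
    also have "\<dots> \<le> c * (c ^ k * \<bar>m N\<bar> + r / 2) + d"
      using Suc c N[of "N + k"] by (intro add_mono mult_left_mono) auto
    also have "\<dots> = c ^ Suc k * \<bar>m N\<bar> + r / 2" by (simp add: d_def field_simps)
    finally show ?case .
  qed
  have "(\<lambda>k. c ^ k * \<bar>m N\<bar>) \<longlonglongrightarrow> 0 * \<bar>m N\<bar>"
    using c by (intro tendsto_intros LIMSEQ_power_zero) auto
  then have "(\<lambda>k. c ^ k * \<bar>m N\<bar>) \<longlonglongrightarrow> 0" by simp
  from LIMSEQ_D[OF this half_gt_zero[OF \<open>0 < r\<close>]]
  obtain k0 where k0: "\<And>k. k \<ge> k0 \<Longrightarrow> \<bar>c ^ k * \<bar>m N\<bar>\<bar> < r / 2" by auto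
  show "\<exists>no. \<forall>n\<ge>no. norm (m n - 0) < r"
  proof (intro exI allI impI)
    fix n assume "n \<ge> N + k0"
    then show "norm (m n - 0) < r"
      using bound[of "n - N"] k0[of "n - N"] abs_ge_self[of "c ^ (n - N) * \<bar>m N\<bar>"]
      by (simp add: le_diff_conv2)
  qed
qed

section \<open>Correlations of the Gibbs measure\<close>

lemma nn_pairs_singleton: "nn_pairs {y} = {{y - 1, y}, {y, y + 1}}"
proof (intro set_eqI iffI)
  fix e assume "e \<in> nn_pairs {y}"
  then obtain a b where e: "e = {a, b}" "\<bar>a - b\<bar> = 1" "a = y \<or> b = y"
    by (auto simp: nn_pairs_def)
  then have "(a = y \<and> (b = y - 1 \<or> b = y + 1)) \<or> (b = y \<and> (a = y - 1 \<or> a = y + 1))" by linarith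
  then show "e \<in> {{y - 1, y}, {y, y + 1}}" using e(1) by auto
next
  fix e assume "e \<in> {{y - 1, y}, {y, y + 1}}"
  then consider "e = {y - 1, y}" | "e = {y, y + 1}" by blast
  then show "e \<in> nn_pairs {y}"
    by cases (force simp: nn_pairs_def)+
qed

lemma boltzmann_weight_singleton:
  "boltzmann_weight K {y} \<eta> \<sigma> = exp (K * (\<sigma> y * (\<eta> (y - 1) + \<eta> (y + 1))))"
proof -
  \<comment> \<open>The sum runs over a set of edges, so the two edges at \<open>y\<close> must be
    distinct to contribute two terms.\<close>
  have "{y - 1, y} \<noteq> {y, y + 1}" by (auto simp: doubleton_eq_iff)
  then show ?thesis
    by (simp add: boltzmann_weight_def nn_pairs_singleton override_on_def algebra_simps)
qed

lemma partition_fun_singleton: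
  "partition_fun K {y} \<eta> = exp (K * (\<eta> (y - 1) + \<eta> (y + 1))) + exp (- (K * (\<eta> (y - 1) + \<eta> (y + 1))))"
proof -
  have "partition_fun K {y} \<eta> = (\<Sum>s\<in>{-1, 1}. exp (K * (s * (\<eta> (y - 1) + \<eta> (y + 1)))))"
    unfolding partition_fun_def boltzmann_weight_singleton
    by (rule sum.reindex_bij_witness[where i="\<lambda>s. \<lambda>x\<in>{y}. s" and j="\<lambda>\<sigma>. \<sigma> y"])
       (auto simp: PiE_def extensional_def fun_eq_iff)
  then show ?thesis by (simp add: algebra_simps)
qed

text \<open>The left-hand side is \<open>tanh (K * (a + b))\<close>, the mean of a spin with
  neighbours \<open>a\<close> and \<open>b\<close>. It is odd in \<open>a + b\<close>, which takes
  only the values -2, 0 and 2, and is therefore linear there.\<close>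

lemma single_site_mean:
  fixes K a b :: real
  assumes "a = -1 \<or> a = 1" "b = -1 \<or> b = 1"
  shows "2 * (exp (K * (a + b)) / (exp (K * (a + b)) + exp (- (K * (a + b))))) - 1
    = tanh (2 * K) / 2 * (a + b)"
proof -
  have pos: "exp (K * 2) + exp (- (K * 2)) \<noteq> 0"
    using exp_gt_zero[of "K * 2"] exp_gt_zero[of "- (K * 2)"] by linarith
  show ?thesis
    using assms pos by (auto simp: tanh_altdef field_simps)
qed

section \<open>Consequences of the single-site DLR equation\<close>

context
  fixes K :: real and P :: "(int \<Rightarrow> real) measure"
  assumes gibbs: "ising_gibbs_measure K P"
begin

interpretation P: prob_space P
  using gibbs by (simp add: ising_gibbs_measure_def)

lemma gibbs_measurable_spin: "(\<lambda>\<eta>. \<eta> y) \<in> measurable P (count_space {-1, 1})"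
proof -
  have "sets P = sets spin_space" using gibbs by (simp add: ising_gibbs_measure_def)
  moreover have "(\<lambda>\<eta>. \<eta> y) \<in> measurable spin_space (count_space {-1, 1})"
    unfolding spin_space_def by (rule measurable_component_singleton) simp
  ultimately show ?thesis by (simp cong: measurable_cong_sets)
qed

lemma space_gibbs: "space P = space spin_space"
  using gibbs by (intro sets_eq_imp_space_eq) (simp add: ising_gibbs_measure_def)

lemma outside_algebra_component:
  assumes "x \<notin> \<Lambda>"
  shows "(\<lambda>\<eta>. \<eta> x) \<in> measurable (outside_algebra \<Lambda>) (count_space {-1, 1})"
proof -
  have "(\<lambda>\<eta>. restrict \<eta> (- \<Lambda>)) \<in> measurable (outside_algebra \<Lambda>) (\<Pi>\<^sub>M x\<in>- \<Lambda>. count_space {-1, 1})"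
    unfolding outside_algebra_def
    by (rule measurable_vimage_algebra1) (auto simp: spin_space_def space_PiM)
  from measurable_compose[OF this measurable_component_singleton[of x]] assms
  show ?thesis by (simp cong: measurable_cong)
qed

lemma subalgebra_outside: "subalgebra P (outside_algebra \<Lambda>)"
proof -
  have "(\<lambda>\<eta>. restrict \<eta> (- \<Lambda>)) \<in> measurable P (\<Pi>\<^sub>M x\<in>- \<Lambda>. count_space {-1, 1})"
    by (intro measurable_restrict gibbs_measurable_spin)
  then show ?thesis
    unfolding subalgebra_def outside_algebra_def space_gibbs[symmetric]
    by (auto simp: dest: subsetD[OF sets_image_in_sets[OF refl], rotated])
qed

text \<open>As \<open>A\<close> does not look at the spin at \<open>y\<close>, the indicator of a
  plus spin at \<open>y\<close> may be replaced under the integral by its conditional probability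
  \<open>W\<close>, and \<open>2 * W - 1\<close> is linear in the neighbouring spins.\<close>

lemma gibbs_single_site:
  assumes A: "A \<in> borel_measurable (outside_algebra {y})" and A1: "\<And>\<eta>. \<eta> \<in> space P \<Longrightarrow> \<bar>A \<eta>\<bar> \<le> 1"
  shows "(\<integral>\<eta>. A \<eta> * \<eta> y \<partial>P) =
    tanh (2 * K) / 2 * ((\<integral>\<eta>. A \<eta> * \<eta> (y - 1) \<partial>P) + (\<integral>\<eta>. A \<eta> * \<eta> (y + 1) \<partial>P))"
proof -
  interpret sub: finite_measure_subalgebra P "outside_algebra {y}"
    by unfold_locales (rule subalgebra_outside)
  have AP: "A \<in> borel_measurable P" by (rule measurable_from_subalg[OF subalgebra_outside A])
  note spin = spin_cases[OF gibbs_measurable_spin]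
  \<comment> \<open>The quantifier over a single site keeps \<open>C\<close> in the form of the
    event in the DLR equation for \<open>{y}\<close> and the constant configuration 1.\<close>
  define C where "C = {\<phi> \<in> space P. \<forall>x\<in>{y}. \<phi> x = (1::real)}"
  define W where "W = (\<lambda>\<eta>. boltzmann_weight K {y} \<eta> (\<lambda>_. 1) / partition_fun K {y} \<eta>)"
  have [measurable]: "(\<lambda>\<eta>. \<eta> z) \<in> borel_measurable P" for z
    by (rule spin_borel_measurable[OF gibbs_measurable_spin])
  have CP [measurable]: "C \<in> sets P" unfolding C_def by measurable
  note AP [measurable]
  have ae: "AE \<eta> in P. real_cond_exp P (outside_algebra {y}) (indicator C) \<eta> = W \<eta>"
    using gibbs unfolding ising_gibbs_measure_def C_def W_def
    by (elim conjE allE[of _ "{y}"] allE[of _ "\<lambda>_. 1"]) simp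
  have W: "2 * W \<eta> - 1 = tanh (2 * K) / 2 * (\<eta> (y - 1) + \<eta> (y + 1))" if "\<eta> \<in> space P" for \<eta>
    unfolding W_def boltzmann_weight_singleton partition_fun_singleton
    using single_site_mean[OF spin[OF that] spin[OF that], of K "y - 1" "y + 1"] by simp
  have intA: "integrable P A"
    by (rule P.integrable_const_bound[where B=1]) (auto intro!: AE_I2 A1)
  have intAs: "integrable P (\<lambda>\<eta>. A \<eta> * \<eta> z)" for z
  proof (rule P.integrable_const_bound[where B=1])
    show "AE \<eta> in P. norm (A \<eta> * \<eta> z) \<le> 1"
    proof (rule AE_I2)
      fix \<eta> assume "\<eta> \<in> space P"
      then show "norm (A \<eta> * \<eta> z) \<le> 1" using A1 spin[of \<eta> z] by (auto simp: abs_mult)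
    qed
  qed simp
  have intC: "integrable P (\<lambda>\<eta>. A \<eta> * indicator C \<eta>)"
    by (rule integrable_real_mult_indicator[OF CP intA])
  have "(\<integral>\<eta>. A \<eta> * indicator C \<eta> \<partial>P) = (\<integral>\<eta>. A \<eta> * real_cond_exp P (outside_algebra {y}) (indicator C) \<eta> \<partial>P)"
    by (rule sub.real_cond_exp_intg(2)[symmetric, OF intC A]) simp
  also have "\<dots> = (\<integral>\<eta>. A \<eta> * ((1 + tanh (2 * K) / 2 * (\<eta> (y - 1) + \<eta> (y + 1))) / 2) \<partial>P)"
  proof (rule integral_cong_AE)
    show "AE \<eta> in P. A \<eta> * real_cond_exp P (outside_algebra {y}) (indicator C) \<eta>
        = A \<eta> * ((1 + tanh (2 * K) / 2 * (\<eta> (y - 1) + \<eta> (y + 1))) / 2)"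
      using ae AE_space
    proof eventually_elim
      case (elim \<eta>)
      have "W \<eta> = (1 + tanh (2 * K) / 2 * (\<eta> (y - 1) + \<eta> (y + 1))) / 2"
        using W[OF elim(2)] by argo
      then show ?case by (simp add: elim(1))
    qed
  qed (simp_all add: borel_measurable_cond_exp2)
  finally have key: "(\<integral>\<eta>. A \<eta> * indicator C \<eta> \<partial>P)
      = (\<integral>\<eta>. A \<eta> * ((1 + tanh (2 * K) / 2 * (\<eta> (y - 1) + \<eta> (y + 1))) / 2) \<partial>P)" .
  \<comment> \<open>A spin equals twice the indicator of its being 1, minus 1.\<close>
  have "(\<integral>\<eta>. A \<eta> * \<eta> y \<partial>P) = (\<integral>\<eta>. 2 * (A \<eta> * indicator C \<eta>) - A \<eta> \<partial>P)"
    by (rule Bochner_Integration.integral_cong[OF refl])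
       (use spin[of _ y] in \<open>force simp: C_def indicator_def\<close>)
  also have "\<dots> = 2 * (\<integral>\<eta>. A \<eta> * indicator C \<eta> \<partial>P) - (\<integral>\<eta>. A \<eta> \<partial>P)"
    using intA intC by simp
  also have "(\<integral>\<eta>. A \<eta> * indicator C \<eta> \<partial>P)
      = (\<integral>\<eta>. A \<eta> / 2 + tanh (2 * K) / 4 * (A \<eta> * \<eta> (y - 1) + A \<eta> * \<eta> (y + 1)) \<partial>P)"
    unfolding key by (rule Bochner_Integration.integral_cong[OF refl]) (simp add: field_simps)
  also have "\<dots> = (\<integral>\<eta>. A \<eta> \<partial>P) / 2 +
      tanh (2 * K) / 4 * ((\<integral>\<eta>. A \<eta> * \<eta> (y - 1) \<partial>P) + (\<integral>\<eta>. A \<eta> * \<eta> (y + 1) \<partial>P))"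
    using intA intAs by simp
  finally show ?thesis by (simp add: field_simps)
qed

lemma gibbs_abs_expectation_le_1:
  fixes A :: "(int \<Rightarrow> real) \<Rightarrow> real"
  assumes [measurable]: "A \<in> borel_measurable P" and "\<And>\<eta>. \<eta> \<in> space P \<Longrightarrow> \<bar>A \<eta>\<bar> \<le> 1"
  shows "\<bar>\<integral>\<eta>. A \<eta> \<partial>P\<bar> \<le> 1"
proof -
  have "\<bar>\<integral>\<eta>. A \<eta> \<partial>P\<bar> \<le> (\<integral>\<eta>. \<bar>A \<eta>\<bar> \<partial>P)" using integral_norm_bound[of P A] by simp
  also have "\<dots> \<le> 1" by (rule P.integral_le_const) (auto intro!: P.integrable_const_bound[where B=1] AE_I2 assms)
  finally show ?thesis .
qed

lemma neighbour_average_le: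
  fixes u v :: real
  assumes "\<bar>u\<bar> \<le> r" "\<bar>v\<bar> \<le> r"
  shows "\<bar>tanh (2 * K) / 2 * (u + v)\<bar> \<le> \<bar>tanh (2 * K)\<bar> * r"
proof -
  have "\<bar>tanh (2 * K) / 2 * (u + v)\<bar> = \<bar>tanh (2 * K)\<bar> * (\<bar>u + v\<bar> / 2)" by (simp add: abs_mult)
  also have "\<dots> \<le> \<bar>tanh (2 * K)\<bar> * r" using assms by (intro mult_left_mono) auto
  finally show ?thesis .
qed

lemma gibbs_mean_spin: "(\<integral>\<eta>. \<eta> y \<partial>P) = 0"
proof -
  note spin = spin_cases[OF gibbs_measurable_spin]
  \<comment> \<open>The bound must hold for all sites at once, since the induction step passes from
    \<open>y\<close> to both neighbours.\<close>
  have le: "\<bar>\<integral>\<eta>. \<eta> y \<partial>P\<bar> \<le> \<bar>tanh (2 * K)\<bar> ^ n" for n y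
  proof (induction n arbitrary: y)
    case 0
    show ?case
      using gibbs_abs_expectation_le_1[OF spin_borel_measurable[OF gibbs_measurable_spin, of y]] spin[of _ y]
      by force
  next
    case (Suc n)
    show ?case
      using gibbs_single_site[of "\<lambda>_. 1" y] neighbour_average_le[OF Suc Suc, of "y - 1" "y + 1"] by simp
  qed
  have "(\<lambda>n. \<bar>tanh (2 * K)\<bar> ^ n) \<longlonglongrightarrow> 0"
    using tanh_real_bounds[of "2 * K"] by (intro LIMSEQ_power_zero) (simp add: abs_less_iff)
  then have "\<bar>\<integral>\<eta>. \<eta> y \<partial>P\<bar> \<le> 0" by (rule LIMSEQ_le_const) (use le in blast)
  then show ?thesis by simp
qed

lemma gibbs_correlation_decay:
  "\<bar>\<integral>\<eta>. \<eta> z * \<eta> y \<partial>P\<bar> \<le> \<bar>tanh (2 * K)\<bar> ^ nat \<bar>y - z\<bar>"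
proof -
  note spin = spin_cases[OF gibbs_measurable_spin]
  note [measurable] = spin_borel_measurable[OF gibbs_measurable_spin]
  \<comment> \<open>One neighbour of \<open>y\<close> lies farther from \<open>z\<close> and the
    other nearer, so the induction carries a lower bound on the distance; a step costs at most 1 of
    it.\<close>
  have "int n \<le> \<bar>y - z\<bar> \<Longrightarrow> \<bar>\<integral>\<eta>. \<eta> z * \<eta> y \<partial>P\<bar> \<le> \<bar>tanh (2 * K)\<bar> ^ n" for n
  proof (induction n arbitrary: y)
    case 0
    have "\<bar>\<eta> z * \<eta> y\<bar> \<le> 1" if "\<eta> \<in> space P" for \<eta>
      using spin[OF that, of z] spin[OF that, of y] by auto
    then show ?case
      using gibbs_abs_expectation_le_1[of "\<lambda>\<eta>. \<eta> z * \<eta> y"] by simp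
  next
    case (Suc n)
    \<comment> \<open>The distance is still at least 1, so \<open>z\<close> lies outside
      \<open>{y}\<close> and the single-site identity applies.\<close>
    have "(\<lambda>\<eta>. \<eta> z) \<in> borel_measurable (outside_algebra {y})"
      using Suc.prems by (intro spin_borel_measurable outside_algebra_component) auto
    moreover have "\<bar>\<eta> z\<bar> \<le> 1" if "\<eta> \<in> space P" for \<eta> using spin[OF that, of z] by auto
    ultimately have "(\<integral>\<eta>. \<eta> z * \<eta> y \<partial>P) =
        tanh (2 * K) / 2 * ((\<integral>\<eta>. \<eta> z * \<eta> (y - 1) \<partial>P) + (\<integral>\<eta>. \<eta> z * \<eta> (y + 1) \<partial>P))"
      by (rule gibbs_single_site)
    moreover have "int n \<le> \<bar>(y - 1) - z\<bar>" "int n \<le> \<bar>(y + 1) - z\<bar>" using Suc.prems by auto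
    ultimately show ?case using neighbour_average_le[OF Suc.IH[of "y - 1"] Suc.IH[of "y + 1"]] by simp
  qed
  then show ?thesis by simp
qed

end

section \<open>Correlations of the dynamic\<close>

text \<open>The update recursion solved at every point, so that the result is an explicit function
  of the initial spins \<open>s\<close> and the noise.\<close>

primrec noise_spin ::
  "real \<Rightarrow> (nat \<Rightarrow> real) \<Rightarrow> (int \<Rightarrow> nat \<Rightarrow> 'w \<Rightarrow> real) \<Rightarrow> (int \<Rightarrow> 'w \<Rightarrow> real) \<Rightarrow> nat \<Rightarrow> int \<Rightarrow> 'w \<Rightarrow> real"
where
  "noise_spin \<gamma> \<kappa> \<xi> s 0 = s"
| "noise_spin \<gamma> \<kappa> \<xi> s (Suc t) = (\<lambda>x \<omega>. sgn (\<kappa> t *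
     (noise_spin \<gamma> \<kappa> \<xi> s t (x - 1) \<omega> + noise_spin \<gamma> \<kappa> \<xi> s t (x + 1) \<omega>)
       + (1 - \<gamma>) * noise_spin \<gamma> \<kappa> \<xi> s t x \<omega> + \<xi> x t \<omega>))"

text \<open>The splitting \<open>sgn (a s + z) = p(z) + s q(z)\<close>, valid for \<open>s = \<plusminus>1\<close>, makes the one-step expectations
  linear in the current spins; \<open>p(z)\<close> has Gaussian mean zero by symmetry.\<close>

definition sgn_even :: "real \<Rightarrow> real \<Rightarrow> real" where
  "sgn_even a z = (sgn (a + z) + sgn (- a + z)) / 2"

definition sgn_odd :: "real \<Rightarrow> real \<Rightarrow> real" where
  "sgn_odd a z = (sgn (a + z) - sgn (- a + z)) / 2"

lemma sgn_spin_split: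
  "s = -1 \<or> s = 1 \<Longrightarrow> sgn (a * s + z) = sgn_even a z + s * sgn_odd a z"
  by (auto simp: sgn_even_def sgn_odd_def field_simps)

lemma abs_sgn_even_le: "\<bar>sgn_even a z\<bar> \<le> 1" and abs_sgn_odd_le: "\<bar>sgn_odd a z\<bar> \<le> 1"
  by (auto simp: sgn_even_def sgn_odd_def sgn_if)

lemma measurable_sgn_even [measurable]: "sgn_even a \<in> borel_measurable borel"
  and measurable_sgn_odd [measurable]: "sgn_odd a \<in> borel_measurable borel"
  by (simp_all add: sgn_even_def[abs_def] sgn_odd_def[abs_def])

context
  fixes M :: "'w measure" and \<phi> \<xi> :: "int \<Rightarrow> nat \<Rightarrow> 'w \<Rightarrow> real"
    and \<gamma> :: real and \<kappa> :: "nat \<Rightarrow> real" and P0 :: "(int \<Rightarrow> real) measure"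
  assumes dyn: "ising_dynamic M \<phi> \<xi> \<gamma> \<kappa> P0"
begin

interpretation prob_space M
  using dyn by (simp add: ising_dynamic_def)

lemma dynamic_spin: "\<phi> x t \<in> measurable M (count_space {-1, 1})"
  using dyn by (simp add: ising_dynamic_def)

lemma dynamic_spin_borel [measurable]: "\<phi> x t \<in> borel_measurable M"
  by (rule spin_borel_measurable[OF dynamic_spin])

lemma dynamic_noise_distributed: "distributed M lborel (\<xi> x t) std_normal_density"
  using dyn by (simp add: ising_dynamic_def)

lemma dynamic_noise_borel [measurable]: "\<xi> x t \<in> borel_measurable M"
  using distributed_measurable[OF dynamic_noise_distributed[of x t]] by simp

lemma dynamic_update: "AE \<omega> in M. \<phi> x (Suc t) \<omega> =
    sgn (\<kappa> t * (\<phi> (x - 1) t \<omega> + \<phi> (x + 1) t \<omega>) + (1 - \<gamma>) * \<phi> x t \<omega> + \<xi> x t \<omega>)"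
  using dyn by (simp add: ising_dynamic_def)

section \<open>Joint independence of the initial configuration and all noise variables\<close>

definition noise_algebra :: "'w measure" where
  "noise_algebra = vimage_algebra (space M) (\<lambda>\<omega> (x, t). \<xi> x t \<omega>) (\<Pi>\<^sub>M _\<in>UNIV. borel)"

definition init_algebra :: "'w measure" where
  "init_algebra = vimage_algebra (space M) (\<lambda>\<omega> x. \<phi> x 0 \<omega>) spin_space"

text \<open>\<open>None\<close> stands for the initial configuration, \<open>Some (x, t)\<close> for the noise variable \<open>\<xi> x t\<close>.\<close>

definition source :: "(int \<times> nat) option \<Rightarrow> 'w set set" where
  "source i = (case i of None \<Rightarrow> sets init_algebra
     | Some (x, t) \<Rightarrow> {\<xi> x t -` A \<inter> space M | A. A \<in> sets borel})"

lemma indep_noise_init: "indep_set (sets noise_algebra) (sets init_algebra)"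
  using dyn by (simp add: ising_dynamic_def noise_algebra_def init_algebra_def)

lemma measurable_noise_algebra: "\<xi> x t \<in> borel_measurable noise_algebra"
proof -
  have "(\<lambda>\<omega> (x, t). \<xi> x t \<omega>) \<in> measurable noise_algebra (\<Pi>\<^sub>M _\<in>UNIV. borel)"
    unfolding noise_algebra_def by (rule measurable_vimage_algebra1) (auto simp: space_PiM)
  from measurable_compose[OF this measurable_component_singleton[of "(x, t)"]]
  show ?thesis by simp
qed

lemma measurable_init_algebra: "\<phi> x 0 \<in> borel_measurable init_algebra"
proof -
  have "(\<lambda>\<omega> x. \<phi> x 0 \<omega>) \<in> measurable init_algebra spin_space"
    unfolding init_algebra_def
    using spin_cases[OF dynamic_spin] by (intro measurable_vimage_algebra1) (auto simp: spin_space_def space_PiM)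
  from measurable_compose[OF this[unfolded spin_space_def] measurable_component_singleton[of x]]
  show ?thesis by (intro spin_borel_measurable) simp
qed

lemma space_noise_algebra: "space noise_algebra = space M"
  and space_init_algebra: "space init_algebra = space M"
  by (simp_all add: noise_algebra_def init_algebra_def)

lemma source_Some_subset: "source (Some p) \<subseteq> sets noise_algebra"
  using measurable_sets[OF measurable_noise_algebra]
  by (auto simp: source_def space_noise_algebra split: prod.splits)

lemma source_events: "source i \<subseteq> events"
  using indep_setD_ev1[OF indep_noise_init] indep_setD_ev2[OF indep_noise_init] source_Some_subset
  by (cases i) (force simp: source_def)+

text \<open>Independence within the noise and independence of the noise as a whole from the initial
  configuration combine: in a finite intersection, the initial event is split off first and the
  noise events are then separated from each other.\<close>

lemma indep_source: "indep_sets source UNIV"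
proof (rule indep_setsI[OF source_events])
  fix A J
  assume J: "J \<noteq> {}" "finite J" and A: "\<forall>j\<in>J. A j \<in> source j"
  define L where "L = Some -` J"
  have L: "finite L" using J by (simp add: L_def finite_vimageI)
  have AL: "A (Some l) \<in> source (Some l)" if "l \<in> L" for l using A that by (simp add: L_def)
  have "indep_vars (\<lambda>_. borel) (\<lambda>(x, t). \<xi> x t) UNIV" using dyn by (simp add: ising_dynamic_def)
  then have "indep_sets (\<lambda>l. source (Some l)) UNIV"
    by (rule indep_sets_mono_sets[OF conjunct2[OF iffD1[OF indep_vars_def2]]])
       (auto simp: source_def split: prod.splits)
  then have prodL: "prob (\<Inter>l\<in>L. A (Some l)) = (\<Prod>l\<in>L. prob (A (Some l)))" if "L \<noteq> {}"
    using indep_setsD[of _ UNIV L "\<lambda>l. A (Some l)"] that L AL by auto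
  show "prob (\<Inter>j\<in>J. A j) = (\<Prod>j\<in>J. prob (A j))"
  proof (cases "None \<in> J")
    case False
    have JL: "J = Some ` L"
    proof (intro set_eqI iffI)
      fix j assume "j \<in> J"
      then show "j \<in> Some ` L" using False by (cases j) (auto simp: L_def)
    qed (auto simp: L_def)
    then have "L \<noteq> {}" using J by auto
    then show ?thesis using prodL by (simp add: JL prod.reindex)
  next
    case True
    have JL: "J = insert None (Some ` L)"
    proof (intro set_eqI iffI)
      fix j assume "j \<in> J"
      then show "j \<in> insert None (Some ` L)" by (cases j) (auto simp: L_def)
    qed (use True in \<open>auto simp: L_def\<close>)
    show ?thesis
    \<comment> \<open>An empty intersection is \<open>UNIV\<close>, which need not be an event, so
      the case without noise events is separate.\<close>
    proof (cases "L = {}")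
      case True then show ?thesis by (simp add: JL)
    next
      case False
      have N: "A None \<in> sets init_algebra" using A True by (auto simp: source_def)
      have "(\<Inter>l\<in>L. A (Some l)) \<in> sets noise_algebra"
        using AL source_Some_subset L False by (intro sets.finite_INT) blast+
      from indep_setD[OF indep_noise_init this N]
      show ?thesis using prodL[OF False] L
        by (simp add: JL prod.reindex Int_commute mult.commute)
    qed
  qed
qed

section \<open>The filtration generated by the initial configuration and the earlier noise\<close>

definition past_index :: "nat \<Rightarrow> (int \<times> nat) option set" where
  "past_index t = insert None (Some ` (UNIV \<times> {..<t}))"

definition past :: "nat \<Rightarrow> 'w measure" where
  "past t = sigma (space M) (\<Union>i\<in>past_index t. source i)"

lemma source_Pow: "(\<Union>i\<in>I. source i) \<subseteq> Pow (space M)"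
  using source_events sets.sets_into_space by blast

lemma space_past: "space (past t) = space M"
  using source_Pow by (simp add: past_def)

lemma sets_past: "sets (past t) = sigma_sets (space M) (\<Union>i\<in>past_index t. source i)"
  using source_Pow by (simp add: past_def)

lemma source_past: "i \<in> past_index t \<Longrightarrow> S \<in> source i \<Longrightarrow> S \<in> sets (past t)"
  unfolding sets_past by (rule sigma_sets.Basic) auto

lemma noise_measurable_past: "s < t \<Longrightarrow> \<xi> x s \<in> borel_measurable (past t)"
  by (intro measurableI source_past[of "Some (x, s)"]) (auto simp: space_past past_index_def source_def)

lemma init_measurable_past: "\<phi> x 0 \<in> borel_measurable (past t)"
  using measurable_sets[OF measurable_init_algebra]
  by (intro measurableI)
     (auto intro!: source_past[of "None"] simp: space_past space_init_algebra past_index_def source_def)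

text \<open>The update equation holds only almost surely, so \<open>\<phi>\<close> itself need not be measurable with
  respect to \<open>past\<close>; \<open>\<psi>\<close> is the version that is. It may take the value \<open>0\<close>.\<close>

abbreviation \<psi> :: "nat \<Rightarrow> int \<Rightarrow> 'w \<Rightarrow> real" where
  "\<psi> \<equiv> noise_spin \<gamma> \<kappa> \<xi> (\<lambda>x. \<phi> x 0)"

text \<open>The spins at time \<open>s\<close> use only noise from times strictly before
  \<open>s\<close>, which is why \<open>past_index\<close> has a strict bound while
  \<open>s = t\<close> is allowed here.\<close>

lemma noise_spin_measurable_past: "s \<le> t \<Longrightarrow> \<psi> s x \<in> borel_measurable (past t)"
proof (induction s arbitrary: x)
  case 0 show ?case by (simp add: init_measurable_past)
next
  case (Suc s)
  have [measurable]: "\<xi> x s \<in> borel_measurable (past t)" "\<And>x. \<psi> s x \<in> borel_measurable (past t)"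
    using Suc by (auto intro: noise_measurable_past)
  show ?case by simp
qed

lemma subalgebra_past: "subalgebra M (past t)"
proof -
  have "sigma_sets (space M) (\<Union>i\<in>past_index t. source i) \<subseteq> events"
    by (rule sets.sigma_sets_subset) (use source_events in blast)
  then show ?thesis by (simp add: subalgebra_def space_past sets_past)
qed

lemma abs_noise_spin_le_1: "\<omega> \<in> space M \<Longrightarrow> \<bar>\<psi> t x \<omega>\<bar> \<le> 1"
  by (cases t) (use spin_cases[OF dynamic_spin, of \<omega> x 0] in \<open>auto simp: sgn_if\<close>)

lemma noise_spin_borel [measurable]: "\<psi> t x \<in> borel_measurable M"
  by (rule measurable_from_subalg[OF subalgebra_past noise_spin_measurable_past[OF order_refl]])

lemma noise_spin_eq: "AE \<omega> in M. \<psi> t x \<omega> = \<phi> x t \<omega>"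
proof (induction t arbitrary: x)
  case 0 show ?case by simp
next
  case (Suc t)
  show ?case using Suc[of x] Suc[of "x - 1"] Suc[of "x + 1"] dynamic_update[of x t]
    by eventually_elim simp
qed

lemma integrable_bounded_by_1:
  fixes Y :: "'w \<Rightarrow> real"
  shows "Y \<in> borel_measurable M \<Longrightarrow> (\<And>\<omega>. \<omega> \<in> space M \<Longrightarrow> \<bar>Y \<omega>\<bar> \<le> 1) \<Longrightarrow> integrable M Y"
  by (rule integrable_const_bound[where B=1]) auto

text \<open>The past of \<open>t\<close> and the noise at time \<open>t\<close> at two distinct
  sites are generated by disjoint groups of independent sources, so expectations of products
  factor.\<close>

lemma expectation_past_noise:
  fixes Y :: "'w \<Rightarrow> real" and U V :: "real \<Rightarrow> real"
  assumes "x1 \<noteq> x2" and Y: "Y \<in> borel_measurable (past t)" "\<And>\<omega>. \<omega> \<in> space M \<Longrightarrow> \<bar>Y \<omega>\<bar> \<le> 1"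
    and U [measurable]: "U \<in> borel_measurable borel" and U1: "\<And>z. \<bar>U z\<bar> \<le> 1"
    and V [measurable]: "V \<in> borel_measurable borel" and V1: "\<And>z. \<bar>V z\<bar> \<le> 1"
  shows "expectation (\<lambda>\<omega>. Y \<omega> * (U (\<xi> x1 t \<omega>) * V (\<xi> x2 t \<omega>)))
    = expectation Y * (expectation (\<lambda>\<omega>. U (\<xi> x1 t \<omega>)) * expectation (\<lambda>\<omega>. V (\<xi> x2 t \<omega>)))"
proof -
  \<comment> \<open>Block 0 is the past, blocks 1 and 2 the two current noise variables;
    \<open>X\<close> lists the matching factors.\<close>
  define I where "I = (\<lambda>n::nat. if n = 0 then past_index t else if n = 1 then {Some (x1, t)} else {Some (x2, t)})"
  define X where "X = (\<lambda>n::nat. if n = 0 then Y else if n = 1 then (\<lambda>\<omega>. U (\<xi> x1 t \<omega>)) else (\<lambda>\<omega>. V (\<xi> x2 t \<omega>)))"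
  have YM [measurable]: "Y \<in> borel_measurable M" by (rule measurable_from_subalg[OF subalgebra_past Y(1)])
  \<comment> \<open>Independence passes from generators to the generated \<sigma>-algebras only when
    the generators are closed under intersection.\<close>
  have Int: "Int_stable (source i)" for i
  proof (cases i)
    case None then show ?thesis by (auto simp: source_def Int_stable_def)
  next
    case (Some p)
    obtain x s where p: "p = (x, s)" by fastforce
    show ?thesis
    proof (rule Int_stableI)
      fix a b assume "a \<in> source i" "b \<in> source i"
      then obtain A B where "a = \<xi> x s -` A \<inter> space M" "b = \<xi> x s -` B \<inter> space M"
        "A \<in> sets borel" "B \<in> sets borel" by (auto simp: source_def Some p)
      then have "a \<inter> b = \<xi> x s -` (A \<inter> B) \<inter> space M" "A \<inter> B \<in> sets borel" by auto
      then show "a \<inter> b \<in> source i" unfolding source_def Some p by (simp only: option.case prod.case) blast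
    qed
  qed
  have disj: "disjoint_family_on I {0, 1, 2}"
    using \<open>x1 \<noteq> x2\<close> by (auto simp: disjoint_family_on_def I_def past_index_def)
  have indep: "indep_sets (\<lambda>j. sigma_sets (space M) (\<Union>i\<in>I j. source i)) {0, 1, 2}"
    by (rule indep_sets_collect_sigma[OF indep_sets_mono_index[OF _ indep_source] Int disj]) simp
  have X: "random_variable borel (X i)" if "i \<in> {0, 1, 2}" for i
    using that by (auto simp: X_def)
  have "indep_vars (\<lambda>_. borel) X {0, 1, 2}"
    unfolding indep_vars_def2
  proof (intro conjI ballI X indep_sets_mono_sets[OF indep])
    fix i :: nat assume i: "i \<in> {0, 1, 2}"
    have noise: "(\<lambda>\<omega>. W (\<xi> x t \<omega>)) -` A \<inter> space M \<in> source (Some (x, t))"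
      if "W \<in> borel_measurable borel" "A \<in> sets borel" for W :: "real \<Rightarrow> real" and A x
      using measurable_sets[OF that] by (auto simp: source_def vimage_def intro!: exI[of _ "W -` A"])
    have "X i -` A \<inter> space M \<in> sigma_sets (space M) (\<Union>i\<in>I i. source i)" if "A \<in> sets borel" for A
    proof -
      consider "i = 0" | "i = 1" | "i = 2" using i by auto
      then show ?thesis
      proof cases
        case 1
        then show ?thesis
          using measurable_sets[OF Y(1) that] by (simp add: X_def I_def space_past sets_past)
      next
        case 2
        then show ?thesis using noise[OF U that] by (auto simp: X_def I_def)
      next
        case 3
        then show ?thesis using noise[OF V that] by (auto simp: X_def I_def)
      qed
    qed
    then show "{X i -` A \<inter> space M |A. A \<in> sets borel} \<subseteq> sigma_sets (space M) (\<Union>i\<in>I i. source i)"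
      by auto
  qed
  then have "expectation (\<lambda>\<omega>. \<Prod>i\<in>{0, 1, 2}. X i \<omega>) = (\<Prod>i\<in>{0, 1, 2}. expectation (X i))"
    using Y(2) U1 V1 by (intro indep_vars_lebesgue_integral) (auto intro!: integrable_bounded_by_1 simp: X_def)
  then show ?thesis by (simp add: X_def mult.assoc)
qed

section \<open>One step of the dynamic without coupling\<close>

lemma expectation_sgn_noise: "expectation (\<lambda>\<omega>. sgn (a + \<xi> x t \<omega>)) = gaussian_sgn_mean a"
  unfolding gaussian_sgn_mean_def
  by (rule distributed_integral[OF dynamic_noise_distributed, symmetric]) auto

lemma expectation_sgn_even: "expectation (\<lambda>\<omega>. sgn_even a (\<xi> x t \<omega>)) = 0"
  and expectation_sgn_odd: "expectation (\<lambda>\<omega>. sgn_odd a (\<xi> x t \<omega>)) = gaussian_sgn_mean a"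
proof -
  have int: "integrable M (\<lambda>\<omega>. sgn (b + \<xi> x t \<omega>))" for b
    by (rule integrable_bounded_by_1) (auto simp: sgn_if)
  show "expectation (\<lambda>\<omega>. sgn_even a (\<xi> x t \<omega>)) = 0"
    "expectation (\<lambda>\<omega>. sgn_odd a (\<xi> x t \<omega>)) = gaussian_sgn_mean a"
    unfolding sgn_even_def sgn_odd_def
    by (simp_all only: Bochner_Integration.integral_divide_zero Bochner_Integration.integral_add[OF int int]
        Bochner_Integration.integral_diff[OF int int] expectation_sgn_noise gaussian_sgn_mean_minus) simp_all
qed

text \<open>Indexed by the time before the step.\<close>

definition free_spin :: "int \<Rightarrow> nat \<Rightarrow> 'w \<Rightarrow> real" where
  "free_spin x t \<omega> = sgn ((1 - \<gamma>) * \<phi> x t \<omega> + \<xi> x t \<omega>)"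

lemma free_spin_borel [measurable]: "free_spin x t \<in> borel_measurable M"
  unfolding free_spin_def[abs_def] by measurable

lemma abs_free_spin_le_1: "\<bar>free_spin x t \<omega>\<bar> \<le> 1"
  by (simp add: free_spin_def sgn_if)

lemma abs_dynamic_spin_le_1: "\<omega> \<in> space M \<Longrightarrow> \<bar>\<phi> x t \<omega>\<bar> \<le> 1"
  using spin_cases[OF dynamic_spin, of \<omega> x t] by auto

text \<open>The splitting of \<open>sgn\<close> needs a spin that is exactly \<plusminus>1, so it is
  applied to \<open>\<phi>\<close>; afterwards \<open>\<psi>\<close> takes its place, so that the
  coefficient of the noise is measurable with respect to \<open>past t\<close>.\<close>

lemma free_spin_split: "AE \<omega> in M. free_spin x t \<omega> =
    sgn_even (1 - \<gamma>) (\<xi> x t \<omega>) + \<psi> t x \<omega> * sgn_odd (1 - \<gamma>) (\<xi> x t \<omega>)"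
  using noise_spin_eq[of t x] AE_space
proof eventually_elim
  case (elim \<omega>)
  then show ?case
    unfolding free_spin_def using sgn_spin_split[OF spin_cases[OF dynamic_spin elim(2)]] by simp
qed

lemma expectation_noise_spin: "expectation (\<psi> t x) = expectation (\<phi> x t)"
  by (rule integral_cong_AE) (auto intro: noise_spin_eq)

lemma expectation_noise_spin_mult:
  "expectation (\<lambda>\<omega>. \<psi> t x \<omega> * \<psi> t y \<omega>) = expectation (\<lambda>\<omega>. \<phi> x t \<omega> * \<phi> y t \<omega>)"
proof (rule integral_cong_AE)
  show "AE \<omega> in M. \<psi> t x \<omega> * \<psi> t y \<omega> = \<phi> x t \<omega> * \<phi> y t \<omega>"
    using noise_spin_eq[of t x] noise_spin_eq[of t y] by eventually_elim simp
qed simp_all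

lemma expectation_free_spin:
  "expectation (free_spin x t) = gaussian_sgn_mean (1 - \<gamma>) * expectation (\<phi> x t)"
proof -
  let ?p = "\<lambda>\<omega>. sgn_even (1 - \<gamma>) (\<xi> x t \<omega>)" and ?q = "\<lambda>\<omega>. sgn_odd (1 - \<gamma>) (\<xi> x t \<omega>)"
  have int: "integrable M ?p" "integrable M (\<lambda>\<omega>. \<psi> t x \<omega> * ?q \<omega>)"
    by (auto intro!: integrable_bounded_by_1 abs_sgn_even_le abs_sgn_odd_le mult_le_one abs_noise_spin_le_1 simp: abs_mult)
  have "expectation (free_spin x t) = expectation (\<lambda>\<omega>. ?p \<omega> + \<psi> t x \<omega> * ?q \<omega>)"
    by (rule integral_cong_AE) (auto intro: free_spin_split)
  \<comment> \<open>The factor 1 is a dummy function of the noise at \<open>x + 1\<close>, giving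
    the product the shape with noise at two distinct sites.\<close>
  also have "\<dots> = expectation (\<lambda>\<omega>. \<psi> t x \<omega> * (?q \<omega> * 1))"
    using int by (simp add: expectation_sgn_even)
  also have "\<dots> = expectation (\<psi> t x) * (gaussian_sgn_mean (1 - \<gamma>) * expectation (\<lambda>_. 1))"
    unfolding expectation_sgn_odd[symmetric, where x=x and t=t]
    by (rule expectation_past_noise[of x "x + 1" _ t _ "\<lambda>_. 1"])
       (auto intro: noise_spin_measurable_past abs_noise_spin_le_1 abs_sgn_odd_le)
  finally show ?thesis by (simp add: expectation_noise_spin prob_space mult.commute)
qed

text \<open>Of the four products obtained from the splitting at \<open>x\<close> and
  \<open>y\<close>, those with an even factor have mean zero, as the two noise variables are
  independent of each other and of the past. The product of the odd parts contributes
  \<open>gaussian_sgn_mean\<close> once per site.\<close>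

lemma expectation_free_spin_mult:
  assumes "x \<noteq> y"
  shows "expectation (\<lambda>\<omega>. free_spin x t \<omega> * free_spin y t \<omega>)
    = (gaussian_sgn_mean (1 - \<gamma>))\<^sup>2 * expectation (\<lambda>\<omega>. \<phi> x t \<omega> * \<phi> y t \<omega>)"
proof -
  let ?p = "\<lambda>x \<omega>. sgn_even (1 - \<gamma>) (\<xi> x t \<omega>)" and ?q = "\<lambda>x \<omega>. sgn_odd (1 - \<gamma>) (\<xi> x t \<omega>)"
  let ?c = "gaussian_sgn_mean (1 - \<gamma>)"
  note bounds = abs_sgn_even_le abs_sgn_odd_le abs_noise_spin_le_1
  have meas [measurable]: "\<psi> t x \<in> borel_measurable (past t)" for x
    by (rule noise_spin_measurable_past) simp
  have int: "integrable M (\<lambda>\<omega>. ?p x \<omega> * ?p y \<omega>)"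
    "integrable M (\<lambda>\<omega>. \<psi> t y \<omega> * (?p x \<omega> * ?q y \<omega>))"
    "integrable M (\<lambda>\<omega>. \<psi> t x \<omega> * (?q x \<omega> * ?p y \<omega>))"
    "integrable M (\<lambda>\<omega>. \<psi> t x \<omega> * \<psi> t y \<omega> * (?q x \<omega> * ?q y \<omega>))"
    by (auto intro!: integrable_bounded_by_1 bounds mult_le_one simp: abs_mult)
  have pp: "expectation (\<lambda>\<omega>. 1 * (?p x \<omega> * ?p y \<omega>)) = 0"
    by (subst expectation_past_noise[OF assms]) (auto intro: bounds simp: expectation_sgn_even)
  have pq: "expectation (\<lambda>\<omega>. \<psi> t y \<omega> * (?p x \<omega> * ?q y \<omega>)) = 0"
    by (subst expectation_past_noise[OF assms]) (auto intro: bounds simp: expectation_sgn_even)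
  have qp: "expectation (\<lambda>\<omega>. \<psi> t x \<omega> * (?q x \<omega> * ?p y \<omega>)) = 0"
    by (subst expectation_past_noise[OF assms]) (auto intro: bounds simp: expectation_sgn_even)
  have qq: "expectation (\<lambda>\<omega>. \<psi> t x \<omega> * \<psi> t y \<omega> * (?q x \<omega> * ?q y \<omega>))
      = expectation (\<lambda>\<omega>. \<phi> x t \<omega> * \<phi> y t \<omega>) * (?c * ?c)"
    by (subst expectation_past_noise[OF assms])
       (auto intro!: bounds mult_le_one simp: expectation_sgn_odd expectation_noise_spin_mult abs_mult)
  have "expectation (\<lambda>\<omega>. free_spin x t \<omega> * free_spin y t \<omega>)
    = expectation (\<lambda>\<omega>. ?p x \<omega> * ?p y \<omega> + \<psi> t y \<omega> * (?p x \<omega> * ?q y \<omega>)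
        + \<psi> t x \<omega> * (?q x \<omega> * ?p y \<omega>) + \<psi> t x \<omega> * \<psi> t y \<omega> * (?q x \<omega> * ?q y \<omega>))"
  proof (rule integral_cong_AE)
    show "AE \<omega> in M. free_spin x t \<omega> * free_spin y t \<omega> = ?p x \<omega> * ?p y \<omega>
        + \<psi> t y \<omega> * (?p x \<omega> * ?q y \<omega>) + \<psi> t x \<omega> * (?q x \<omega> * ?p y \<omega>)
        + \<psi> t x \<omega> * \<psi> t y \<omega> * (?q x \<omega> * ?q y \<omega>)"
      using free_spin_split[of x t] free_spin_split[of y t]
      by eventually_elim (simp add: algebra_simps)
  qed simp_all
  also have "\<dots> = ?c\<^sup>2 * expectation (\<lambda>\<omega>. \<phi> x t \<omega> * \<phi> y t \<omega>)"
    using int pp pq qp qq by (simp add: power2_eq_square)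
  finally show ?thesis .
qed

section \<open>Comparison with the coupled dynamic and decay of mean and correlation\<close>

lemma integrable_spins: "integrable M (\<phi> x t)" "integrable M (free_spin x t)"
  "integrable M (\<lambda>\<omega>. \<phi> x t \<omega> * \<phi> y t \<omega>)" "integrable M (\<lambda>\<omega>. free_spin x t \<omega> * free_spin y t \<omega>)"
  by (auto intro!: integrable_bounded_by_1 abs_dynamic_spin_le_1 abs_free_spin_le_1 mult_le_one simp: abs_mult)

text \<open>The coupling term is at most \<open>2 * \<bar>\<kappa> t\<bar>\<close> in absolute
  value, so it can change the sign only when the uncoupled argument is that small.\<close>

lemma free_spin_coupling:
  "expectation (\<lambda>\<omega>. \<bar>\<phi> x (Suc t) \<omega> - free_spin x t \<omega>\<bar>) \<le> 16 * \<bar>\<kappa> t\<bar>"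
proof -
  \<comment> \<open>As the current spin is \<plusminus>1, the small-argument event lies in the union
    of \<open>D b\<close> for the two constants \<open>b = 1 - \<gamma>\<close> and
    \<open>b = - (1 - \<gamma>)\<close>. Each has probability at most
    \<open>4 * \<bar>\<kappa> t\<bar>\<close> and signs differ by at most 2, whence the constant
    16.\<close>
  define D where "D = (\<lambda>b. {\<omega>\<in>space M. \<bar>b + \<xi> x t \<omega>\<bar> \<le> 2 * \<bar>\<kappa> t\<bar>})"
  have D [measurable]: "D b \<in> events" for b unfolding D_def by measurable
  have probD: "prob (D b) \<le> 4 * \<bar>\<kappa> t\<bar>" for b
    using std_normal_small_ball[OF dynamic_noise_distributed, of "2 * \<bar>\<kappa> t\<bar>" b x t] by (simp add: D_def)
  have indD: "integrable M (indicator (D b) :: 'w \<Rightarrow> real)" for b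
    by (rule integrable_bounded_by_1) (auto simp: indicator_def)
  have AE: "AE \<omega> in M. \<bar>\<phi> x (Suc t) \<omega> - free_spin x t \<omega>\<bar>
      \<le> 2 * indicator (D (1 - \<gamma>)) \<omega> + 2 * indicator (D (- (1 - \<gamma>))) \<omega>"
    using dynamic_update[of x t] AE_space
  proof eventually_elim
    case (elim \<omega>)
    define r where "r = \<kappa> t * (\<phi> (x - 1) t \<omega> + \<phi> (x + 1) t \<omega>)"
    define u where "u = (1 - \<gamma>) * \<phi> x t \<omega> + \<xi> x t \<omega>"
    have "\<bar>\<phi> (x - 1) t \<omega> + \<phi> (x + 1) t \<omega>\<bar> \<le> 2"
      using abs_dynamic_spin_le_1[OF elim(2), of "x - 1" t] abs_dynamic_spin_le_1[OF elim(2), of "x + 1" t]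
      by linarith
    then have r: "\<bar>r\<bar> \<le> 2 * \<bar>\<kappa> t\<bar>"
      using mult_left_mono[of "\<bar>\<phi> (x - 1) t \<omega> + \<phi> (x + 1) t \<omega>\<bar>" 2 "\<bar>\<kappa> t\<bar>"] by (simp add: r_def abs_mult)
    have \<phi>: "\<phi> x (Suc t) \<omega> = sgn (r + u)" "free_spin x t \<omega> = sgn u"
      using elim(1) by (simp_all add: r_def u_def free_spin_def add.assoc)
    show ?case
    proof (cases "\<bar>u\<bar> \<le> 2 * \<bar>\<kappa> t\<bar>")
      case True
      then have "\<omega> \<in> D (1 - \<gamma>) \<or> \<omega> \<in> D (- (1 - \<gamma>))"
        using spin_cases[OF dynamic_spin elim(2), of x t] elim(2) by (auto simp: D_def u_def)
      moreover have "\<bar>sgn (r + u) - sgn u\<bar> \<le> 2" by (auto simp: sgn_if)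
      ultimately show ?thesis by (auto simp: \<phi> indicator_def)
    next
      case False
      then have "sgn (r + u) = sgn u" using r by (auto simp: sgn_if abs_if split: if_splits)
      then show ?thesis by (simp add: \<phi>)
    qed
  qed
  have "expectation (\<lambda>\<omega>. \<bar>\<phi> x (Suc t) \<omega> - free_spin x t \<omega>\<bar>)
      \<le> expectation (\<lambda>\<omega>. 2 * indicator (D (1 - \<gamma>)) \<omega> + 2 * indicator (D (- (1 - \<gamma>))) \<omega>)"
    by (intro integral_mono_AE integrable_abs Bochner_Integration.integrable_diff integrable_spins
        Bochner_Integration.integrable_add integrable_mult_right indD) (use AE in simp)
  also have "\<dots> = 2 * prob (D (1 - \<gamma>)) + 2 * prob (D (- (1 - \<gamma>)))"
    by (simp add: indD)
  also have "\<dots> \<le> 16 * \<bar>\<kappa> t\<bar>" using probD[of "1 - \<gamma>"] probD[of "- (1 - \<gamma>)"] by simp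
  finally show ?thesis .
qed

lemma abs_expectation_diff_le:
  fixes Y Z :: "'w \<Rightarrow> real"
  assumes "integrable M Y" "integrable M Z"
  shows "\<bar>expectation Y\<bar> \<le> \<bar>expectation Z\<bar> + expectation (\<lambda>\<omega>. \<bar>Y \<omega> - Z \<omega>\<bar>)"
  using integral_norm_bound[of M "\<lambda>\<omega>. Y \<omega> - Z \<omega>"] assms by simp

lemma dynamic_mean_step:
  "\<bar>expectation (\<phi> x (Suc t))\<bar> \<le> \<bar>gaussian_sgn_mean (1 - \<gamma>)\<bar> * \<bar>expectation (\<phi> x t)\<bar> + 16 * \<bar>\<kappa> t\<bar>"
  using abs_expectation_diff_le[OF integrable_spins(1)[of x "Suc t"] integrable_spins(2)[of x t]] free_spin_coupling[of x t]
  by (simp add: expectation_free_spin abs_mult)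

lemma dynamic_correlation_step:
  assumes "x \<noteq> y"
  shows "\<bar>expectation (\<lambda>\<omega>. \<phi> x (Suc t) \<omega> * \<phi> y (Suc t) \<omega>)\<bar>
    \<le> (gaussian_sgn_mean (1 - \<gamma>))\<^sup>2 * \<bar>expectation (\<lambda>\<omega>. \<phi> x t \<omega> * \<phi> y t \<omega>)\<bar> + 32 * \<bar>\<kappa> t\<bar>"
proof -
  let ?d = "\<lambda>x \<omega>. \<bar>\<phi> x (Suc t) \<omega> - free_spin x t \<omega>\<bar>"
  have int: "integrable M (?d x)" for x
    by (intro integrable_abs Bochner_Integration.integrable_diff integrable_spins)
  have "expectation (\<lambda>\<omega>. \<bar>\<phi> x (Suc t) \<omega> * \<phi> y (Suc t) \<omega> - free_spin x t \<omega> * free_spin y t \<omega>\<bar>)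
      \<le> expectation (\<lambda>\<omega>. ?d x \<omega> + ?d y \<omega>)"
  proof (rule integral_mono)
    fix \<omega> assume w: "\<omega> \<in> space M"
    \<comment> \<open>Changing one factor at a time, with the other bounded by 1, adds up the two
      single-site errors; hence 32.\<close>
    have "\<phi> x (Suc t) \<omega> * \<phi> y (Suc t) \<omega> - free_spin x t \<omega> * free_spin y t \<omega>
      = (\<phi> x (Suc t) \<omega> - free_spin x t \<omega>) * \<phi> y (Suc t) \<omega> + free_spin x t \<omega> * (\<phi> y (Suc t) \<omega> - free_spin y t \<omega>)"
      by (simp add: algebra_simps)
    also have "\<bar>\<dots>\<bar> \<le> ?d x \<omega> * \<bar>\<phi> y (Suc t) \<omega>\<bar> + \<bar>free_spin x t \<omega>\<bar> * ?d y \<omega>"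
      unfolding abs_mult[symmetric] by (rule abs_triangle_ineq)
    also have "\<dots> \<le> ?d x \<omega> + ?d y \<omega>"
      using mult_left_le[OF abs_dynamic_spin_le_1[OF w, of y "Suc t"], of "?d x \<omega>"]
        mult_left_le_one_le[OF _ _ abs_free_spin_le_1[of x t \<omega>], of "?d y \<omega>"] by simp
    finally show "\<bar>\<phi> x (Suc t) \<omega> * \<phi> y (Suc t) \<omega> - free_spin x t \<omega> * free_spin y t \<omega>\<bar> \<le> ?d x \<omega> + ?d y \<omega>" .
  qed (intro integrable_abs Bochner_Integration.integrable_diff Bochner_Integration.integrable_add integrable_spins)+
  also have "\<dots> = expectation (?d x) + expectation (?d y)"
    by (rule Bochner_Integration.integral_add[OF int int])
  also have "\<dots> \<le> 32 * \<bar>\<kappa> t\<bar>" using free_spin_coupling[of x t] free_spin_coupling[of y t] by simp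
  finally show ?thesis
    using abs_expectation_diff_le[OF integrable_spins(3)[of x "Suc t" y] integrable_spins(4)[of x t y]]
    by (simp add: expectation_free_spin_mult[OF assms] abs_mult)
qed

lemma dynamic_mean_tendsto:
  assumes "\<kappa> \<longlonglongrightarrow> 0"
  shows "(\<lambda>t. expectation (\<phi> x t)) \<longlonglongrightarrow> 0"
proof (rule contraction_tendsto_zero[where c="\<bar>gaussian_sgn_mean (1 - \<gamma>)\<bar>" and e="\<lambda>t. 16 * \<bar>\<kappa> t\<bar>"])
  show "(\<lambda>t. 16 * \<bar>\<kappa> t\<bar>) \<longlonglongrightarrow> 0"
    using tendsto_mult_right_zero[OF tendsto_rabs_zero[OF assms]] .
qed (simp_all add: abs_gaussian_sgn_mean_less_1 dynamic_mean_step)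

lemma dynamic_correlation_tendsto:
  assumes "\<kappa> \<longlonglongrightarrow> 0" "x \<noteq> y"
  shows "(\<lambda>t. expectation (\<lambda>\<omega>. \<phi> x t \<omega> * \<phi> y t \<omega>)) \<longlonglongrightarrow> 0"
proof (rule contraction_tendsto_zero[where c="(gaussian_sgn_mean (1 - \<gamma>))\<^sup>2" and e="\<lambda>t. 32 * \<bar>\<kappa> t\<bar>"])
  show "(gaussian_sgn_mean (1 - \<gamma>))\<^sup>2 < 1"
    using abs_gaussian_sgn_mean_less_1 by (simp add: abs_square_less_1)
  show "(\<lambda>t. 32 * \<bar>\<kappa> t\<bar>) \<longlonglongrightarrow> 0"
    using tendsto_mult_right_zero[OF tendsto_rabs_zero[OF assms(1)]] .
qed (simp_all add: dynamic_correlation_step[OF assms(2)])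

end

theorem corollary5p4:
  fixes M :: "'w measure"
    and \<phi> \<xi> :: "int \<Rightarrow> nat \<Rightarrow> 'w \<Rightarrow> real"
    and P0 :: "(int \<Rightarrow> real) measure"
    and \<gamma> K :: real
    and lam :: "nat \<Rightarrow> real"        (* scaling factor lambda(t) *)
    and Kc :: "real \<Rightarrow> real"        (* coupling K_lambda as a function of lambda *)
    and f g :: "real \<Rightarrow> real"       (* only evaluated at -1 and 1 *)
    and x1 x2 :: int
  assumes "K > 0"
    and "ising_gibbs_measure K P0"
    and "ising_dynamic M \<phi> \<xi> \<gamma> (\<lambda>t. Kc (lam t)) P0"
    and "\<And>t. lam t > 0"
    and "\<And>t. lam t * of_int x1 \<in> \<int>"
    and "\<And>t. lam t * of_int x2 \<in> \<int>"
    and "filterlim lam at_top sequentially"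
    and "(\<lambda>t. Kc (lam t)) \<longlonglongrightarrow> 0"
    and "x1 \<noteq> x2"
  shows "(\<lambda>t. dyn_entropy M \<phi> f g t x1 x2
            - gibbs_entropy P0 f g \<lfloor>lam t * of_int x1\<rfloor> \<lfloor>lam t * of_int x2\<rfloor>) \<longlonglongrightarrow> 0"
proof -
  define h where "h = (\<lambda>r s. (f r)\<^sup>2 * (g s)\<^sup>2)"
  define y1 where "y1 = (\<lambda>t. \<lfloor>lam t * of_int x1\<rfloor>)"
  define y2 where "y2 = (\<lambda>t. \<lfloor>lam t * of_int x2\<rfloor>)"
  \<comment> \<open>The entropy for two independent fair spins, which is the common limit.\<close>
  define L where "L = uniform_mean (\<lambda>r s. h r s * ln (h r s)) - uniform_mean h * ln (uniform_mean h)"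
  note gibbs = \<open>ising_gibbs_measure K P0\<close> and dyn = \<open>ising_dynamic M \<phi> \<xi> \<gamma> (\<lambda>t. Kc (lam t)) P0\<close>
  note \<kappa> = \<open>(\<lambda>t. Kc (lam t)) \<longlonglongrightarrow> 0\<close>
  interpret M: prob_space M using dyn by (simp add: ising_dynamic_def)
  interpret P: prob_space P0 using gibbs by (simp add: ising_gibbs_measure_def)
  \<comment> \<open>The observable is taken at time \<open>t + 1\<close>, so the limits for mean and
    correlation are shifted by one step.\<close>
  have "(\<lambda>t. entropy_functional M (\<lambda>\<omega>. h (\<phi> x1 (Suc t) \<omega>) (\<phi> x2 (Suc t) \<omega>))) \<longlonglongrightarrow> L"
    unfolding L_def
    by (intro M.entropy_spin_pair_limit dynamic_spin[OF dyn]
        LIMSEQ_Suc[OF dynamic_mean_tendsto[OF dyn \<kappa>]]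
        LIMSEQ_Suc[OF dynamic_correlation_tendsto[OF dyn \<kappa> \<open>x1 \<noteq> x2\<close>]])
       (simp add: h_def)
  moreover have "(\<lambda>t. entropy_functional P0 (\<lambda>\<eta>. h (\<eta> (y1 t)) (\<eta> (y2 t)))) \<longlonglongrightarrow> L"
    unfolding L_def
  proof (intro P.entropy_spin_pair_limit gibbs_measurable_spin[OF gibbs])
    \<comment> \<open>Distinct integer sites are at least 1 apart, so scaling separates them by at
      least \<open>lam t\<close>; the subtracted 1 allows for the two floors.\<close>
    have dist: "lam t - 1 \<le> real (nat \<bar>y2 t - y1 t\<bar>)" for t
    proof -
      have "lam t * 1 \<le> lam t * real_of_int \<bar>x2 - x1\<bar>"
        using \<open>\<And>t. lam t > 0\<close>[of t] \<open>x1 \<noteq> x2\<close> by (intro mult_left_mono) linarith+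
      also have "\<dots> = \<bar>lam t * of_int x2 - lam t * of_int x1\<bar>"
        using \<open>\<And>t. lam t > 0\<close>[of t] by (simp add: abs_mult flip: right_diff_distrib)
      finally have "lam t \<le> \<bar>lam t * of_int x2 - lam t * of_int x1\<bar>" by simp
      then show ?thesis unfolding y1_def y2_def by linarith
    qed
    have "filterlim (\<lambda>t. nat \<bar>y2 t - y1 t\<bar>) at_top sequentially"
      unfolding filterlim_at_top
    proof
      fix n :: nat
      have "eventually (\<lambda>t. real n + 1 \<le> lam t) sequentially"
        using \<open>filterlim lam at_top sequentially\<close> by (simp add: filterlim_at_top)
      then show "eventually (\<lambda>t. n \<le> nat \<bar>y2 t - y1 t\<bar>) sequentially"
      proof eventually_elim
        case (elim t)
        then show ?case using dist[of t] by linarith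
      qed
    qed
    moreover have "(\<lambda>n. \<bar>tanh (2 * K)\<bar> ^ n) \<longlonglongrightarrow> 0"
      using tanh_real_bounds[of "2 * K"] by (intro LIMSEQ_power_zero) (simp add: abs_less_iff)
    ultimately have "(\<lambda>t. \<bar>tanh (2 * K)\<bar> ^ nat \<bar>y2 t - y1 t\<bar>) \<longlonglongrightarrow> 0"
      by (rule filterlim_compose[rotated])
    then show "(\<lambda>t. \<integral>\<eta>. \<eta> (y1 t) * \<eta> (y2 t) \<partial>P0) \<longlonglongrightarrow> 0"
      by (rule Lim_null_comparison[rotated]) (simp add: gibbs_correlation_decay[OF gibbs])
  qed (simp_all add: h_def gibbs_mean_spin[OF gibbs])
  ultimately show ?thesis
    using tendsto_diff by (fastforce simp: dyn_entropy_def gibbs_entropy_def h_def y1_def y2_def)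
qed

end
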